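(* Let $n\ge2$ and let $Y=\{y_1,y_2,y_3\}$ be an (ordered) three point set in $\mathbb{CH}^n=\mathbb{B}^n$. The set $Y$ lies in a real geodesic disk if and only if $Y\sim X$ for some $X\in\mathcal B$, if and only if $A_{123}=0$, where $A_{123}$ is computed for the points $y_1,y_2,y_3$.
   Context: $\mathbb{B}^n\subset\mathbb{C}^n$ is the open unit ball, the model of complex hyperbolic space $\mathbb{CH}^n$; $\operatorname{Aut}(\mathbb{B}^n)$ is its group of biholomorphic automorphisms. For ordered sets, $Y\sim X$ (congruence) means some $\Lambda\in\operatorname{Aut}(\mathbb{B}^n)$ maps $Y$ to $X$ respecting the order. A real geodesic disk is an image, under an element of $\operatorname{Aut}(\mathbb{B}^n)$, of $\{(x,y,0,\dots,0):x,y\in\mathbb{R},\ x^2+y^2<1\}$. $\mathcal B$ is the collection of ordered three point sets $X=\{(0,0),(s,0),(w,t)\}\subset\mathbb{B}^2$ with $s>0$, $w\in\mathbb{R}$, $t>0$; here $\mathbb{B}^2$ is regarded as the subset of $\mathbb{B}^n$ of points whose last $n-2$ coordinates vanish. With $k_{ij}=(1-\langle y_j,y_i\rangle)^{-1}$ (the Gram matrix entries of the Drury-Arveson kernels at the points $y_i$), $A_{123}=\arg(k_{12}k_{23}k_{31})$, $|\arg|\le\pi$.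
   Formalization: Triples on a single real geodesic, e.g. 0, (1/3,0), (1/2,0), lie in a real geodesic disk with A_123=0 but are congruent to no X in B (t>0), so "Y~X for some X in B" is shown equivalent to lying in a real geodesic disk and in no real geodesic. *)

theory Defs
  imports "HOL-Analysis.Analysis"
begin

text \<open>
  Points of \<open>\<complex>\<^sup>n\<close> have type \<open>complex ^ 'n\<close>, whose norm is the Hermitian one, so that \<open>ball 0 1\<close> is
  the open unit ball. An index type carries no order; the role of the first two coordinates is
  played by two distinct indices \<open>i\<close> and \<open>j\<close>, which are explicit parameters below;
  such indices exist exactly when \<open>n \<ge> 2\<close>.
  Ordered finite sets are lists.
\<close>

text \<open>Intended for open \<open>S\<close>: the Frechet derivative exists and is complex linear.\<close>

definition holomorphic_map_on :: "(complex ^ 'n \<Rightarrow> complex ^ 'm) \<Rightarrow> (complex ^ 'n) set \<Rightarrow> bool"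
  where "holomorphic_map_on f S \<longleftrightarrow>
    (\<forall>z\<in>S. \<exists>D. (f has_derivative D) (at z) \<and> (\<forall>c v. D (c *s v) = c *s D v))"

text \<open>Only the values of \<open>\<Lambda>\<close> on the ball matter.\<close>

definition Aut_ball :: "(complex ^ 'n \<Rightarrow> complex ^ 'n) set"
  where "Aut_ball = {\<Lambda>. bij_betw \<Lambda> (ball 0 1) (ball 0 1) \<and>
    holomorphic_map_on \<Lambda> (ball 0 1) \<and>
    holomorphic_map_on (inv_into (ball 0 1) \<Lambda>) (ball 0 1)}"

definition congruent_pts :: "(complex ^ 'n) list \<Rightarrow> (complex ^ 'n) list \<Rightarrow> bool"
  where "congruent_pts Y X \<longleftrightarrow> (\<exists>\<Lambda>\<in>Aut_ball. map \<Lambda> Y = X)"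

definition plane_pt :: "'n \<Rightarrow> 'n \<Rightarrow> complex \<Rightarrow> complex \<Rightarrow> complex ^ 'n"
  where "plane_pt i j a b = axis i a + axis j b"

definition real_geodesic_disks :: "'n \<Rightarrow> 'n \<Rightarrow> (complex ^ 'n) set set"
  where "real_geodesic_disks i j =
    {\<Lambda> ` {plane_pt i j (of_real x) (of_real y) | x y :: real. x\<^sup>2 + y\<^sup>2 < 1} | \<Lambda>. \<Lambda> \<in> Aut_ball}"

text \<open>
  A triple on a real geodesic lies in a real geodesic disk but is congruent to no triple
  \<open>0, (s, 0), (w, t)\<close> with \<open>t > 0\<close>, because automorphisms preserve real
  geodesics and those through \<open>0\<close> are diameters. Real geodesics are needed to single out this
  degenerate case.
\<close>

definition real_geodesics :: "'n \<Rightarrow> (complex ^ 'n) set set"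
  where "real_geodesics i =
    {\<Lambda> ` {axis i (of_real x) | x :: real. x\<^sup>2 < 1} | \<Lambda>. \<Lambda> \<in> Aut_ball}"

definition normal_triples :: "'n \<Rightarrow> 'n \<Rightarrow> (complex ^ 'n) list set"
  where "normal_triples i j =
    {X. \<exists>s w t :: real. s > 0 \<and> t > 0 \<and>
      X = [0, plane_pt i j (of_real s) 0, plane_pt i j (of_real w) (of_real t)] \<and>
      set X \<subseteq> ball 0 1}"

definition hermitian_inner :: "complex ^ 'n \<Rightarrow> complex ^ 'n \<Rightarrow> complex"
  where "hermitian_inner x y = (\<Sum>k\<in>UNIV. x $ k * cnj (y $ k))"

text \<open>Gram matrix entry \<open>k\<^sub>i\<^sub>j\<close> for \<open>x = y\<^sub>i\<close> and \<open>y = y\<^sub>j\<close>; note the order of the arguments.\<close>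

definition DA_gram :: "complex ^ 'n \<Rightarrow> complex ^ 'n \<Rightarrow> complex"
  where "DA_gram x y = inverse (1 - hermitian_inner y x)"

definition angular_invariant ::
    "complex ^ 'n \<Rightarrow> complex ^ 'n \<Rightarrow> complex ^ 'n \<Rightarrow> real"
  where "angular_invariant y1 y2 y3 = Arg (DA_gram y1 y2 * DA_gram y2 y3 * DA_gram y3 y1)"

end

theory Submission
  imports Defs "HOL-Complex_Analysis.Conformal_Mappings"
begin

text \<open>
  An automorphism fixing the origin is unitary: the Schwarz lemma, applied to it and to its
  inverse along complex lines, makes it norm preserving, and equality in the Schwarz lemma makes it
  homogeneous, hence equal to its derivative at \<open>0\<close>. Composing with the involution that exchanges
  \<open>\<Lambda> 0\<close> and \<open>0\<close> reduces every automorphism \<open>\<Lambda>\<close> to a unitary map. The involution changes the triple product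
  \<open>k\<^sub>1\<^sub>2 k\<^sub>2\<^sub>3 k\<^sub>3\<^sub>1\<close> only by a positive factor, so its argument is invariant. After moving \<open>y\<^sub>1\<close> to
  \<open>0\<close>, a vanishing argument says that \<open>\<langle>y\<^sub>3, y\<^sub>2\<rangle>\<close> is real, and two unitary reflections then
  move \<open>y\<^sub>2\<close> and \<open>y\<^sub>3\<close> into the real plane.
\<close>

section \<open>The Hermitian inner product\<close>

lemma hermitian_inner_add_left: "hermitian_inner (x + y) z = hermitian_inner x z + hermitian_inner y z"
  by (simp add: hermitian_inner_def sum.distrib algebra_simps)

lemma hermitian_inner_add_right: "hermitian_inner x (y + z) = hermitian_inner x y + hermitian_inner x z"
  by (simp add: hermitian_inner_def sum.distrib algebra_simps)

lemma hermitian_inner_diff_left: "hermitian_inner (x - y) z = hermitian_inner x z - hermitian_inner y z"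
  by (simp add: hermitian_inner_def sum_subtractf algebra_simps)

lemma hermitian_inner_diff_right: "hermitian_inner x (y - z) = hermitian_inner x y - hermitian_inner x z"
  by (simp add: hermitian_inner_def sum_subtractf algebra_simps)

lemma hermitian_inner_scale_left: "hermitian_inner (c *s x) y = c * hermitian_inner x y"
  by (simp add: hermitian_inner_def sum_distrib_left algebra_simps)

lemma hermitian_inner_scale_right: "hermitian_inner x (c *s y) = cnj c * hermitian_inner x y"
  by (simp add: hermitian_inner_def sum_distrib_left algebra_simps)

lemmas hermitian_inner_sesquilinear =
  hermitian_inner_add_left hermitian_inner_add_right
  hermitian_inner_diff_left hermitian_inner_diff_right
  hermitian_inner_scale_left hermitian_inner_scale_right

lemma hermitian_inner_zero [simp]: "hermitian_inner 0 x = 0" "hermitian_inner x 0 = 0"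
  by (simp_all add: hermitian_inner_def)

lemma cnj_hermitian_inner: "cnj (hermitian_inner x y) = hermitian_inner y x"
  by (simp add: hermitian_inner_def algebra_simps)

lemma hermitian_inner_axis: "hermitian_inner x (axis k 1) = x $ k"
  by (simp add: hermitian_inner_def axis_def if_distrib cong: if_cong)

lemma hermitian_inner_self: "hermitian_inner x x = of_real ((norm x)\<^sup>2)"
proof -
  have "(norm x)\<^sup>2 = (\<Sum>k\<in>UNIV. (cmod (x $ k))\<^sup>2)"
    by (simp add: norm_vec_def L2_set_def sum_nonneg)
  then show ?thesis
    by (simp add: hermitian_inner_def complex_norm_square del: of_real_power)
qed

text \<open>Gives access to Cauchy-Schwarz and polarization in the underlying real inner product
  space.\<close>

lemma Re_hermitian_inner: "Re (hermitian_inner x y) = x \<bullet> y"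
  by (simp add: hermitian_inner_def inner_vec_def inner_complex_def)

lemma norm_scale: "norm (c *s x) = cmod c * norm (x :: complex ^ 'n)"
proof -
  have "of_real ((norm (c *s x))\<^sup>2) = complex_of_real ((cmod c * norm x)\<^sup>2)"
    unfolding hermitian_inner_self [symmetric] hermitian_inner_sesquilinear
    by (simp add: hermitian_inner_self power_mult_distrib complex_norm_square mult_ac del: of_real_power)
  then have "(norm (c *s x))\<^sup>2 = (cmod c * norm x)\<^sup>2"
    using of_real_eq_iff by blast
  then show ?thesis
    by (simp add: power2_eq_iff_nonneg)
qed

text \<open>A unit scalar \<open>c\<close> rotates the product onto the nonnegative reals, where it
  equals \<open>(c *s x) \<bullet> y\<close>; the real Cauchy-Schwarz inequality then
  applies.\<close>

lemma norm_hermitian_inner_le: "cmod (hermitian_inner x y) \<le> norm x * norm y"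
proof -
  obtain c where c: "cmod c = 1" "c * hermitian_inner x y = of_real (cmod (hermitian_inner x y))"
  proof (cases "hermitian_inner x y = 0")
    case False
    then show ?thesis
      by (intro that [of "cnj (hermitian_inner x y) / of_real (cmod (hermitian_inner x y))"])
        (auto simp: norm_divide field_simps power2_eq_square complex_norm_square [symmetric, unfolded of_real_power])
  qed (auto intro: that [of 1])
  then have "cmod (hermitian_inner x y) = (c *s x) \<bullet> y"
    by (simp add: hermitian_inner_scale_left flip: Re_hermitian_inner)
  also have "\<dots> \<le> norm x * norm y"
    using norm_cauchy_schwarz [of "c *s x" y] c(1) by (simp add: norm_scale)
  finally show ?thesis .
qed

text \<open>Supplies the differentiation rules for \<open>*s\<close> needed for slices and for the
  involutions.\<close>

lemma bounded_bilinear_scale: "bounded_bilinear ((*s) :: complex \<Rightarrow> complex ^ 'n \<Rightarrow> complex ^ 'n)"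
proof
  show "\<exists>K. \<forall>c (x :: complex ^ 'n). norm (c *s x) \<le> norm c * norm x * K"
    by (rule exI [of _ 1]) (simp add: norm_scale)
qed (vector algebra_simps)+

lemma bounded_linear_hermitian_inner: "bounded_linear (\<lambda>x. hermitian_inner x a)"
proof
  show "hermitian_inner (r *\<^sub>R x) a = r *\<^sub>R hermitian_inner x a" for r x
    by (simp add: hermitian_inner_def scaleR_sum_right)
  show "\<exists>K. \<forall>x. norm (hermitian_inner x a) \<le> norm x * K"
    using norm_hermitian_inner_le by blast
qed (simp add: hermitian_inner_add_left)

section \<open>Automorphisms of the ball\<close>

lemma holomorphic_map_on_compose:
  assumes f: "holomorphic_map_on f S" and g: "holomorphic_map_on g T" and "f ` S \<subseteq> T"
  shows "holomorphic_map_on (g \<circ> f) S"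
  unfolding holomorphic_map_on_def
proof
  fix z assume z: "z \<in> S"
  obtain D where D: "(f has_derivative D) (at z)" "\<And>c v. D (c *s v) = c *s D v"
    using f z unfolding holomorphic_map_on_def by blast
  have "f z \<in> T" using assms(3) z by blast
  then obtain E where E: "(g has_derivative E) (at (f z))" "\<And>c v. E (c *s v) = c *s E v"
    using g unfolding holomorphic_map_on_def by blast
  show "\<exists>D. (g \<circ> f has_derivative D) (at z) \<and> (\<forall>c v. D (c *s v) = c *s D v)"
    using diff_chain_at [OF D(1) E(1)] D(2) E(2) by (intro exI [of _ "E \<circ> D"]) simp
qed

lemma holomorphic_map_on_cong:
  assumes f: "holomorphic_map_on f S" and "open S" and eq: "\<And>z. z \<in> S \<Longrightarrow> f z = g z"
  shows "holomorphic_map_on g S"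
  using f unfolding holomorphic_map_on_def
  by (metis has_derivative_transform_within_open [OF _ \<open>open S\<close>] eq)

text \<open>An explicit inverse on the ball agrees there with \<open>inv_into\<close>, and
  holomorphy on an open set depends only on the values there; concrete maps can thus be treated
  without \<open>inv_into\<close>.\<close>

lemma Aut_ballI:
  assumes "holomorphic_map_on f (ball 0 1)" "holomorphic_map_on g (ball 0 1)"
    and "\<And>z. norm z < 1 \<Longrightarrow> norm (f z) < 1" "\<And>z. norm z < 1 \<Longrightarrow> norm (g z) < 1"
    and gf: "\<And>z. norm z < 1 \<Longrightarrow> g (f z) = z" and fg: "\<And>z. norm z < 1 \<Longrightarrow> f (g z) = z"
  shows "f \<in> Aut_ball"
proof -
  have bij: "bij_betw f (ball 0 1) (ball 0 1)"
    by (rule bij_betw_byWitness [where f' = g]) (use assms in auto)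
  have "g z = inv_into (ball 0 1) f z" if "z \<in> ball 0 1" for z
    using that assms bij by (intro inv_into_f_eq [symmetric]) (auto simp: bij_betw_def)
  then have "holomorphic_map_on (inv_into (ball 0 1) f) (ball 0 1)"
    using assms(2) by (rule holomorphic_map_on_cong [rotated 2]) auto
  then show ?thesis
    using bij assms(1) by (simp add: Aut_ball_def)
qed

lemma Aut_ballD:
  assumes "f \<in> Aut_ball"
  obtains g where "g \<in> Aut_ball" "\<And>z. norm z < 1 \<Longrightarrow> norm (f z) < 1" "\<And>z. norm z < 1 \<Longrightarrow> norm (g z) < 1"
    "\<And>z. norm z < 1 \<Longrightarrow> g (f z) = z" "\<And>z. norm z < 1 \<Longrightarrow> f (g z) = z"
proof
  define g where "g = inv_into (ball 0 1) f"
  have bij: "bij_betw f (ball 0 1) (ball 0 1)"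
    and hol: "holomorphic_map_on f (ball 0 1)" "holomorphic_map_on g (ball 0 1)"
    using assms by (auto simp: Aut_ball_def g_def)
  have bij': "bij_betw g (ball 0 1) (ball 0 1)"
    unfolding g_def using bij by (rule bij_betw_inv_into)
  show f: "norm (f z) < 1" and g: "norm (g z) < 1" if "norm z < 1" for z
    using bij_betw_apply [OF bij, of z] bij_betw_apply [OF bij', of z] that by auto
  show gf: "g (f z) = z" and fg: "f (g z) = z" if "norm z < 1" for z
    using that bij bij_betw_inv_into_left [OF bij, of z] bij_betw_inv_into_right [OF bij, of z]
    by (auto simp: g_def)
  show "g \<in> Aut_ball"
    using hol f g gf fg by (intro Aut_ballI [of g f]) auto
qed

lemma Aut_ball_compose:
  assumes "f \<in> Aut_ball" "g \<in> Aut_ball"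
  shows "g \<circ> f \<in> Aut_ball"
proof -
  obtain f' where f': "f' \<in> Aut_ball" "\<And>z. norm z < 1 \<Longrightarrow> norm (f z) < 1"
    "\<And>z. norm z < 1 \<Longrightarrow> norm (f' z) < 1"
    "\<And>z. norm z < 1 \<Longrightarrow> f' (f z) = z" "\<And>z. norm z < 1 \<Longrightarrow> f (f' z) = z"
    using Aut_ballD [OF assms(1)] by blast
  obtain g' where g': "g' \<in> Aut_ball" "\<And>z. norm z < 1 \<Longrightarrow> norm (g z) < 1"
    "\<And>z. norm z < 1 \<Longrightarrow> norm (g' z) < 1"
    "\<And>z. norm z < 1 \<Longrightarrow> g' (g z) = z" "\<And>z. norm z < 1 \<Longrightarrow> g (g' z) = z"
    using Aut_ballD [OF assms(2)] by blast
  have hol: "holomorphic_map_on h (ball 0 1)" if "h \<in> Aut_ball" for h :: "complex ^ 'a \<Rightarrow> _"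
    using that by (simp add: Aut_ball_def)
  show ?thesis
  proof (rule Aut_ballI [where g = "f' \<circ> g'"])
    show "holomorphic_map_on (g \<circ> f) (ball 0 1)" "holomorphic_map_on (f' \<circ> g') (ball 0 1)"
      by (rule holomorphic_map_on_compose [where T = "ball 0 1"]; use assms f' g' hol in auto)+
  qed (use f' g' in auto)
qed

section \<open>Unitary maps\<close>

text \<open>Norm preservation is what the Schwarz lemma delivers; preservation of inner products and
  surjectivity are derived from it.\<close>

definition unitary_map :: "(complex ^ 'n \<Rightarrow> complex ^ 'n) \<Rightarrow> bool" where
  "unitary_map D \<longleftrightarrow> (\<forall>x y. D (x + y) = D x + D y) \<and> (\<forall>c x. D (c *s x) = c *s D x) \<and>
    (\<forall>x. norm (D x) = norm x)"

lemma unitary_map_compose: "unitary_map D \<Longrightarrow> unitary_map E \<Longrightarrow> unitary_map (E \<circ> D)"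
  by (simp add: unitary_map_def)

text \<open>Polarization settles the real parts, and the imaginary part of a product is the real
  part after multiplying \<open>x\<close> by \<open>- \<i>\<close>.\<close>

lemma unitary_map_hermitian_inner:
  assumes "unitary_map D"
  shows "hermitian_inner (D x) (D y) = hermitian_inner x y"
proof -
  have add: "D (x + y) = D x + D y" and scale: "D (c *s x) = c *s D x" and norm: "norm (D x) = norm x"
    for c x y using assms by (auto simp: unitary_map_def)
  have inner: "D x \<bullet> D y = x \<bullet> y" for x y
    by (metis add norm dot_norm)
  have Im: "Im (hermitian_inner x y) = ((- \<i>) *s x) \<bullet> y" for x y :: "complex ^ 'a"
    unfolding Re_hermitian_inner [symmetric] hermitian_inner_scale_left by simp
  show ?thesis
    by (rule complex_eqI) (simp_all only: Re_hermitian_inner inner Im flip: scale)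
qed

lemma unitary_map_zero: "unitary_map D \<Longrightarrow> D 0 = 0"
  by (metis norm_eq_zero unitary_map_def)

lemma unitary_map_linear:
  assumes "unitary_map D"
  shows "linear D"
proof (rule linearI)
  have "r *\<^sub>R x = complex_of_real r *s x" for r and x :: "complex ^ 'a"
    by vector (simp add: scaleR_conv_of_real)
  then show "D (r *\<^sub>R x) = r *\<^sub>R D x" for r x
    using assms by (simp add: unitary_map_def)
qed (use assms in \<open>simp add: unitary_map_def\<close>)

lemma unitary_map_holomorphic:
  assumes "unitary_map D"
  shows "holomorphic_map_on D S"
  unfolding holomorphic_map_on_def
  using assms linear_imp_has_derivative [OF unitary_map_linear [OF assms]]
  by (auto simp: unitary_map_def)

text \<open>Norm preservation gives injectivity; in finite dimension an injective linear
  endomorphism is invertible, and the inverse is again unitary.\<close>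

lemma unitary_map_Aut_ball:
  assumes "unitary_map D"
  shows "D \<in> Aut_ball"
proof -
  have lin: "linear D" and scale: "D (c *s x) = c *s D x" and norm: "norm (D x) = norm x" for c x
    using assms unitary_map_linear by (auto simp: unitary_map_def)
  have "inj D"
    using lin by (simp add: linear_injective_0) (metis norm norm_eq_zero)
  then obtain E where E: "linear E" "\<And>x. E (D x) = x" "\<And>x. D (E x) = x"
    using linear_injective_isomorphism [OF lin] by blast
  have "unitary_map E"
    unfolding unitary_map_def by (metis E linear_add norm scale)
  then show ?thesis
    using E assms by (intro Aut_ballI [of D E]) (auto simp: unitary_map_holomorphic unitary_map_def)
qed

text \<open>
  A complex reflection along \<open>d = u - v\<close>: it is isometric because
  \<open>norm u = norm v\<close> gives \<open>\<langle>d, d\<rangle> = 2 Re \<langle>u, d\<rangle>\<close>. For \<open>u = v\<close> division by zero makes it the identity.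
\<close>

lemma exists_unitary_reflection:
  fixes u v :: "complex ^ 'n"
  assumes "norm u = norm v"
  obtains R where "unitary_map R" "R u = v"
    "\<And>x. hermitian_inner x u = 0 \<Longrightarrow> hermitian_inner x v = 0 \<Longrightarrow> R x = x"
proof
  define d where "d = u - v"
  define \<gamma> where "\<gamma> = hermitian_inner u d"
  define R where "R x = x - (hermitian_inner x d / \<gamma>) *s d" for x
  have uv: "hermitian_inner u u = hermitian_inner v v"
    using assms by (simp add: hermitian_inner_self)
  then have dd: "hermitian_inner d d = \<gamma> + cnj \<gamma>"
    by (simp add: d_def \<gamma>_def hermitian_inner_sesquilinear cnj_hermitian_inner)
  \<comment> \<open>A vanishing denominator forces \<open>norm d = 0\<close>, so division by zero
    occurs only for \<open>u = v\<close>.\<close>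
  have \<gamma>0: "d = 0" if "\<gamma> = 0"
    using dd that by (simp add: hermitian_inner_self)
  have "hermitian_inner (R x) (R x) = hermitian_inner x x" for x
  proof (cases "\<gamma> = 0")
    case True
    then show ?thesis by (simp add: R_def)
  next
    case False
    then have "cnj \<gamma> \<noteq> 0" by simp
    have "hermitian_inner d x = cnj (hermitian_inner x d)"
      by (simp add: cnj_hermitian_inner)
    with False \<open>cnj \<gamma> \<noteq> 0\<close> show ?thesis
      by (simp add: R_def hermitian_inner_sesquilinear dd) (simp add: field_simps)
  qed
  then have "norm (R x) = norm x" for x
    by (simp add: hermitian_inner_self) (metis norm_ge_zero of_real_eq_iff of_real_power power2_eq_iff_nonneg)
  moreover have "R (x + y) = R x + R y" "R (c *s x) = c *s R x" for x y c
    unfolding R_def hermitian_inner_sesquilinear by (vector field_simps add_divide_distrib)+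
  ultimately show "unitary_map R"
    by (simp add: unitary_map_def)
  show "R u = v"
    using \<gamma>0 by (cases "\<gamma> = 0") (auto simp: R_def d_def simp flip: \<gamma>_def [unfolded d_def])
  show "R x = x" if "hermitian_inner x u = 0" "hermitian_inner x v = 0" for x
    using that by (simp add: R_def d_def hermitian_inner_sesquilinear)
qed

section \<open>Moving two vectors into the real plane\<close>

lemma axis_eq_scale: "axis k c = c *s axis k (1 :: complex)"
  by (simp add: vec_eq_iff axis_def)

lemma norm_plane_pt:
  assumes "i \<noteq> j"
  shows "(norm (plane_pt i j (of_real x) (of_real y)))\<^sup>2 = x\<^sup>2 + y\<^sup>2"
proof -
  have "complex_of_real ((norm (plane_pt i j (of_real x) (of_real y)))\<^sup>2) = of_real (x\<^sup>2 + y\<^sup>2)"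
    using assms
    unfolding hermitian_inner_self [symmetric] plane_pt_def axis_eq_scale [of _ "of_real _"]
      hermitian_inner_sesquilinear hermitian_inner_axis
    by (simp add: axis_def power2_eq_square)
  then show ?thesis
    using of_real_eq_iff by blast
qed

text \<open>A first reflection sends \<open>z2\<close> to a positive multiple of \<open>e i\<close>.
  The coordinate of \<open>R z3\<close> along \<open>e i\<close> is then the given product divided
  by \<open>s\<close>, hence real. The remainder \<open>r\<close> is orthogonal to
  \<open>e i\<close>, so a second reflection turns it into \<open>norm r\<close> times
  \<open>e j\<close> and fixes \<open>e i\<close>. The case \<open>t = 0\<close> occurs when
  \<open>z3\<close> is a real multiple of \<open>z2\<close>.\<close>

lemma exists_unitary_normal_form:
  fixes i j :: "'n::finite" and z2 z3 :: "complex ^ 'n"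
  assumes "i \<noteq> j" "z2 \<noteq> 0" "hermitian_inner z3 z2 \<in> \<real>"
  obtains U and s w t :: real where "unitary_map U" "s > 0" "t \<ge> 0"
    "U z2 = plane_pt i j (of_real s) 0" "U z3 = plane_pt i j (of_real w) (of_real t)"
proof -
  define s where "s = norm z2"
  define e where "e k = axis k (1 :: complex)" for k :: 'n
  have s: "s > 0" using assms(2) by (simp add: s_def)
  have ne: "norm (e k) = 1" for k by (simp add: e_def)
  obtain R where R: "unitary_map R" "R z2 = of_real s *s e i"
    using exists_unitary_reflection [of z2 "of_real s *s e i"] s
    by (auto simp: norm_scale ne s_def)
  have "of_real s * R z3 $ i = hermitian_inner z3 z2"
    using unitary_map_hermitian_inner [OF R(1), of z3 z2]
    by (simp add: R(2) hermitian_inner_sesquilinear e_def hermitian_inner_axis)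
  with s have "R z3 $ i = hermitian_inner z3 z2 / of_real s"
    by (simp add: field_simps)
  then have "R z3 $ i \<in> \<real>"
    using assms(3) by (auto intro!: Reals_divide)
  then obtain w where w: "R z3 $ i = of_real w"
    by (auto elim: Reals_cases)
  define r where "r = R z3 - of_real w *s e i"
  define t where "t = norm r"
  obtain R' where R': "unitary_map R'" "R' r = of_real t *s e j"
    "\<And>x. hermitian_inner x r = 0 \<Longrightarrow> hermitian_inner x (of_real t *s e j) = 0 \<Longrightarrow> R' x = x"
    using exists_unitary_reflection [of r "of_real t *s e j"]
    by (auto simp: norm_scale ne t_def)
  have "hermitian_inner r (e i) = 0"
    by (simp add: r_def w e_def hermitian_inner_axis)
  then have "hermitian_inner (e i) r = 0"
    by (metis cnj_hermitian_inner complex_cnj_zero)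
  moreover have "hermitian_inner (e i) (of_real t *s e j) = 0"
    using assms(1) by (simp add: e_def hermitian_inner_sesquilinear hermitian_inner_axis) (simp add: axis_def)
  ultimately have R'e: "R' (e i) = e i"
    by (rule R'(3))
  have R'lin: "R' (x + y) = R' x + R' y" "R' (c *s x) = c *s R' x" for x y c
    using R'(1) by (auto simp: unitary_map_def)
  have "R z3 = r + of_real w *s e i"
    by (simp add: r_def)
  then have "R' (R z3) = of_real t *s e j + of_real w *s e i"
    by (simp add: R'lin R'(2) R'e)
  then have "(R' \<circ> R) z3 = plane_pt i j (of_real w) (of_real t)"
    by (simp add: plane_pt_def axis_eq_scale [of _ "of_real _"] e_def)
  moreover have "(R' \<circ> R) z2 = plane_pt i j (of_real s) 0"
    by (simp add: plane_pt_def axis_eq_scale [of _ "of_real _"] e_def R R'lin R'e [unfolded e_def])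
  moreover have "t \<ge> 0" by (simp add: t_def)
  ultimately show thesis
    using that [of "R' \<circ> R" s t w] s unitary_map_compose [OF R(1) R'(1)] by blast
qed

section \<open>Automorphisms fixing the origin\<close>

text \<open>Restriction to a complex line and pairing with a fixed vector produce a scalar function,
  to which the one-variable Schwarz lemma applies.\<close>

lemma holomorphic_slice:
  assumes F: "holomorphic_map_on F (ball 0 1)" and u: "norm u = 1"
  shows "(\<lambda>c. hermitian_inner (F (c *s u)) v) holomorphic_on ball 0 1"
proof -
  have "\<exists>f'. ((\<lambda>c. hermitian_inner (F (c *s u)) v) has_field_derivative f') (at c)"
    if "c \<in> ball 0 1" for c
  proof -
    have "c *s u \<in> ball 0 1"
      using that u by (simp add: norm_scale)
    then obtain D where D: "(F has_derivative D) (at (c *s u))" "\<And>c v. D (c *s v) = c *s D v"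
      using F unfolding holomorphic_map_on_def by blast
    have "((\<lambda>c. c *s u) has_derivative (\<lambda>c. c *s u)) (at c)"
      by (intro bounded_linear_imp_has_derivative
          bounded_bilinear.bounded_linear_left [OF bounded_bilinear_scale])
    then have "((\<lambda>c. F (c *s u)) has_derivative (\<lambda>h. D (h *s u))) (at c)"
      using diff_chain_at [of "\<lambda>c. c *s u" _ c F D] D(1) by (simp add: o_def)
    then have "((\<lambda>c. hermitian_inner (F (c *s u)) v) has_derivative
        (\<lambda>h. hermitian_inner (D (h *s u)) v)) (at c)"
      by (rule bounded_linear.has_derivative [OF bounded_linear_hermitian_inner])
    \<comment> \<open>Complex linearity of \<open>D\<close> makes the derivative a multiplication by
      the constant \<open>hermitian_inner (D u) v\<close>.\<close>
    then show ?thesis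
      unfolding has_field_derivative_def
      by (intro exI [of _ "hermitian_inner (D u) v"])
        (simp add: D(2) hermitian_inner_scale_left mult.commute [of _ "hermitian_inner (D u) v"] )
  qed
  then show ?thesis
    unfolding holomorphic_on_def field_differentiable_def
    using has_field_derivative_at_within by blast
qed

context
  fixes F :: "complex ^ 'n \<Rightarrow> complex ^ 'n"
  assumes holF: "holomorphic_map_on F (ball 0 1)" and F0: "F 0 = 0"
    and Fball: "\<And>z. norm z < 1 \<Longrightarrow> norm (F z) < 1"
begin

lemma slice_Schwarz:
  fixes u v :: "complex ^ 'n"
  assumes "norm u = 1" "norm v = 1"
  defines "f \<equiv> \<lambda>c. hermitian_inner (F (c *s u)) v"
  shows "f holomorphic_on ball 0 1" "f 0 = 0" "\<And>c. cmod c < 1 \<Longrightarrow> cmod (f c) < 1"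
proof -
  show "f holomorphic_on ball 0 1"
    unfolding f_def using holF assms(1) by (rule holomorphic_slice)
  show "f 0 = 0"
    by (simp add: f_def F0)
  show "cmod (f c) < 1" if "cmod c < 1" for c
    using norm_hermitian_inner_le [of "F (c *s u)" v] Fball [of "c *s u"] that assms
    by (simp add: f_def norm_scale)
qed

text \<open>The slice runs along the direction \<open>u\<close> of \<open>z\<close> and is paired
  with the direction \<open>v\<close> of \<open>F z\<close>; at the parameter \<open>norm z\<close>
  its value is exactly \<open>norm (F z)\<close>.\<close>

lemma ball_Schwarz:
  assumes "norm z < 1"
  shows "norm (F z) \<le> norm z"
proof (cases "z = 0 \<or> F z = 0")
  case True
  then show ?thesis using F0 by auto
next
  case False
  define u where "u = inverse (complex_of_real (norm z)) *s z"
  define v where "v = inverse (complex_of_real (norm (F z))) *s F z"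
  have uv: "norm u = 1" "norm v = 1"
    using False by (auto simp: u_def v_def norm_scale norm_inverse)
  have "of_real (norm z) *s u = z"
    using False by (simp add: u_def)
  moreover have "hermitian_inner (F z) v = of_real (norm (F z))"
    using False by (simp add: v_def hermitian_inner_sesquilinear hermitian_inner_self power2_eq_square)
  ultimately show ?thesis
    using Schwarz_Lemma(1) [OF slice_Schwarz [OF uv], of "of_real (norm z)"] assms by simp
qed

text \<open>The slice through \<open>z\<close>, paired with the direction of \<open>F z\<close>,
  attains equality in the Schwarz lemma at \<open>r = norm z\<close>, so it is linear, with slope
  \<open>1\<close>. Since \<open>F (b *s u)\<close> has norm \<open>cmod b\<close> and pairs with
  \<open>v\<close> to \<open>b\<close>, it must equal \<open>b *s v\<close>; the choice
  \<open>b = c * r\<close> gives the claim.\<close>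

lemma homogeneous_if_norm_preserving:
  assumes isom: "\<And>z. norm z < 1 \<Longrightarrow> norm (F z) = norm z" and z: "norm z < 1" and c: "norm (c *s z) < 1"
  shows "F (c *s z) = c *s F z"
proof (cases "z = 0")
  case True
  then show ?thesis by (simp add: F0)
next
  case False
  define r where "r = complex_of_real (norm z)"
  define u where "u = inverse r *s z"
  define v where "v = inverse r *s F z"
  have r: "r \<noteq> 0" using False by (simp add: r_def)
  have uv: "norm u = 1" "norm v = 1"
    using False isom [OF z] by (auto simp: u_def v_def norm_scale norm_inverse r_def)
  have ru: "r *s u = z" and rv: "r *s v = F z"
    using r by (simp_all add: u_def v_def)
  have fr: "hermitian_inner (F (r *s u)) v = r"
    unfolding ru rv [symmetric]
    by (simp add: hermitian_inner_sesquilinear hermitian_inner_self uv)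
  moreover have r1: "cmod r < 1"
    using z by (simp add: r_def)
  ultimately have "\<exists>c. cmod c < 1 \<and> c \<noteq> 0 \<and> cmod (hermitian_inner (F (c *s u)) v) = cmod c"
    using r by metis
  then obtain \<alpha> where \<alpha>: "\<And>b. cmod b < 1 \<Longrightarrow> hermitian_inner (F (b *s u)) v = \<alpha> * b"
    using Schwarz_Lemma(3) [OF slice_Schwarz [OF uv], of 0] by (metis norm_zero zero_less_one)
  have "\<alpha> = 1"
    using \<alpha> [OF r1] fr r by simp
  define b where "b = c * r"
  have b: "cmod b < 1"
    using c by (simp add: b_def r_def norm_scale norm_mult)
  have Fb: "hermitian_inner (F (b *s u)) v = b"
    using \<alpha> [OF b] \<open>\<alpha> = 1\<close> by simp
  then have Fb': "hermitian_inner v (F (b *s u)) = cnj b"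
    by (metis cnj_hermitian_inner)
  have nFb: "norm (F (b *s u)) = cmod b"
    using isom [of "b *s u"] b uv by (simp add: norm_scale)
  \<comment> \<open>equality in Cauchy--Schwarz\<close>
  have "hermitian_inner (F (b *s u) - b *s v) (F (b *s u) - b *s v) = 0"
    unfolding hermitian_inner_sesquilinear Fb Fb'
    by (simp add: hermitian_inner_self nFb uv complex_norm_square mult_ac del: of_real_power)
  then have "F (b *s u) = b *s v"
    by (simp add: hermitian_inner_self)
  moreover have "b *s u = c *s z" "b *s v = c *s F z"
    by (simp_all add: b_def ru rv flip: vector_smult_assoc)
  ultimately show ?thesis by simp
qed

end

text \<open>Homogeneity does not include additivity; the latter is obtained by identifying
  \<open>F\<close> with its derivative at \<open>0\<close> along each real segment through
  \<open>0\<close>.\<close>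

lemma Aut_ball_fixing_zero:
  assumes "F \<in> Aut_ball" "F 0 = 0"
  obtains D where "unitary_map D" "\<And>z. norm z < 1 \<Longrightarrow> F z = D z"
proof -
  obtain G where G: "G \<in> Aut_ball" and bF: "\<And>z. norm z < 1 \<Longrightarrow> norm (F z) < 1"
    and bG: "\<And>z. norm z < 1 \<Longrightarrow> norm (G z) < 1"
    and GF: "\<And>z. norm z < 1 \<Longrightarrow> G (F z) = z" and FG: "\<And>z. norm z < 1 \<Longrightarrow> F (G z) = z"
    using Aut_ballD [OF assms(1)] by blast
  have hol: "holomorphic_map_on F (ball 0 1)" "holomorphic_map_on G (ball 0 1)"
    using assms G by (auto simp: Aut_ball_def)
  have "G 0 = 0" using GF [of 0] assms(2) by simp
  have isom: "norm (F z) = norm z" if "norm z < 1" for z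
    using ball_Schwarz [OF hol(1) assms(2) bF that]
      ball_Schwarz [OF hol(2) \<open>G 0 = 0\<close> bG bF [OF that]] GF [OF that] by simp
  obtain D where D: "(F has_derivative D) (at 0)" "\<And>c v. D (c *s v) = c *s D v"
    using hol(1) unfolding holomorphic_map_on_def by (metis centre_in_ball zero_less_one)
  have FD: "F z = D z" if z: "norm z < 1" for z
  proof -
    have "((\<lambda>t. t *\<^sub>R z) has_derivative (\<lambda>t. t *\<^sub>R z)) (at 0)"
      by (intro derivative_eq_intros) auto
    then have 1: "((\<lambda>t. F (t *\<^sub>R z)) has_derivative (\<lambda>t. D (t *\<^sub>R z))) (at 0)"
      using diff_chain_at [of "\<lambda>t. t *\<^sub>R z" _ 0 F D] D(1) by (simp add: o_def)
    have scale: "t *\<^sub>R x = of_real t *s x" for t :: real and x :: "complex ^ 'a"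
      by vector (simp add: scaleR_conv_of_real)
    have "F (t *\<^sub>R z) = t *\<^sub>R F z" if "t \<in> ball 0 1" for t
    proof -
      have "norm (of_real t *s z) < 1"
        using that z mult_strict_mono' [of "\<bar>t\<bar>" 1 "norm z" 1] by (simp add: norm_scale)
      then show ?thesis
        using homogeneous_if_norm_preserving [OF hol(1) assms(2) bF isom z] by (simp add: scale)
    qed
    \<comment> \<open>Near \<open>t = 0\<close> the curve \<open>F (t *\<^sub>R z)\<close> is linear
      in \<open>t\<close>, so uniqueness of its derivative compares \<open>D z\<close> with
      \<open>F z\<close>.\<close>
    then have "((\<lambda>t. t *\<^sub>R F z) has_derivative (\<lambda>t. D (t *\<^sub>R z))) (at 0)"
      by (intro has_derivative_transform_within_open [OF 1, of "ball 0 1"]) auto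
    moreover have "((\<lambda>t. t *\<^sub>R F z) has_derivative (\<lambda>t. t *\<^sub>R F z)) (at 0)"
      by (intro derivative_eq_intros) auto
    ultimately have "(\<lambda>t. D (t *\<^sub>R z)) = (\<lambda>t. t *\<^sub>R F z)"
      by (rule has_derivative_unique)
    from fun_cong [OF this, of 1] show ?thesis by simp
  qed
  have "norm (D x) = norm x" for x
  proof (cases "x = 0")
    case True
    then show ?thesis using FD [of 0] assms(2) by simp
  next
    case False
    \<comment> \<open>Scaling to norm \<open>1 / 2\<close> brings \<open>x\<close> into the ball,
      where \<open>D\<close> agrees with \<open>F\<close>; homogeneity of \<open>D\<close> removes
      the factor again.\<close>
    define c where "c = complex_of_real (1 / (2 * norm x))"
    have "norm (c *s x) = 1 / 2"
      using False by (simp add: c_def norm_scale norm_divide norm_mult)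
    then have "norm (D (c *s x)) = norm (c *s x)"
      using FD [of "c *s x"] isom [of "c *s x"] by simp
    moreover have "c \<noteq> 0" using False by (simp add: c_def)
    ultimately show ?thesis
      by (simp add: D(2) norm_scale)
  qed
  moreover have "D (x + y) = D x + D y" for x y
    using has_derivative_linear [OF D(1)] by (rule linear_add)
  ultimately have "unitary_map D"
    using D(2) by (simp add: unitary_map_def)
  then show thesis using FD that by blast
qed

section \<open>The involutions exchanging a point and the origin\<close>

context
  fixes a :: "complex ^ 'n"
  assumes a: "norm a < 1"
begin

definition defect :: real where "defect = sqrt (1 - (norm a)\<^sup>2)"

text \<open>
  The usual \<open>(a - P z - s (z - P z)) / (1 - \<langle>z, a\<rangle>)\<close>, \<open>P\<close> the projection onto \<open>\<complex> a\<close> and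
  \<open>s = defect\<close>; the factor \<open>(1 - s) / (norm a)\<^sup>2 = 1 / (1 + s)\<close> avoids a case distinction at \<open>a = 0\<close>.
\<close>

definition ball_involution :: "complex ^ 'n \<Rightarrow> complex ^ 'n" where
  "ball_involution z = inverse (1 - hermitian_inner z a) *s
    ((1 - hermitian_inner z a / (1 + of_real defect)) *s a - of_real defect *s z)"

lemma defect_pos: "defect > 0"
  using a by (simp add: defect_def power_less_one_iff)

lemma defect_nonzero: "complex_of_real defect \<noteq> 0" "1 + complex_of_real defect \<noteq> 0"
  using defect_pos by (simp_all add: complex_eq_iff)

lemma hermitian_inner_defect: "hermitian_inner a a = 1 - (of_real defect)\<^sup>2"
proof -
  have "(norm a)\<^sup>2 = 1 - defect\<^sup>2"
    using a by (simp add: defect_def power_le_one_iff)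
  then show ?thesis
    by (simp add: hermitian_inner_self flip: of_real_power)
qed

lemma one_minus_hermitian_inner_nonzero:
  assumes "norm z < 1"
  shows "1 - hermitian_inner z a \<noteq> 0" "1 - hermitian_inner a z \<noteq> 0"
proof -
  have "norm z * norm a < 1"
    using a assms mult_strict_mono' [of "norm z" 1 "norm a" 1] by simp
  then have "cmod (hermitian_inner z a) < 1" "cmod (hermitian_inner a z) < 1"
    using norm_hermitian_inner_le [of z a] norm_hermitian_inner_le [of a z] by (auto simp: mult.commute)
  then show "1 - hermitian_inner z a \<noteq> 0" "1 - hermitian_inner a z \<noteq> 0"
    by auto
qed

text \<open>The transformation law of the Drury-Arveson kernel. It shows both that the ball is
  preserved and how the triple product changes.\<close>

lemma ball_involution_kernel:
  assumes "norm z < 1" "norm w < 1"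
  shows "1 - hermitian_inner (ball_involution z) (ball_involution w) =
    (of_real defect)\<^sup>2 * (1 - hermitian_inner z w) /
      ((1 - hermitian_inner z a) * (1 - hermitian_inner a w))"
proof -
  define s where "s = complex_of_real defect"
  define p q r where "p = hermitian_inner z a" and "q = hermitian_inner a w" and "r = hermitian_inner z w"
  have nz: "1 - p \<noteq> 0" "1 - q \<noteq> 0" "1 + s \<noteq> 0"
    using one_minus_hermitian_inner_nonzero assms defect_nonzero by (auto simp: p_def q_def s_def)
  define P Q where "P = inverse (1 - p)" and "Q = inverse (1 - q)"
  \<comment> \<open>Writing \<open>p\<close> and \<open>q\<close> as multiples of
    \<open>1 + s\<close> clears the denominators, so the numerator identity becomes
    polynomial.\<close>
  define x y where "x = p / (1 + s)" and "y = q / (1 + s)"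
  have pq: "p = x * (1 + s)" "q = y * (1 + s)"
    using nz by (simp_all add: x_def y_def)
  have cnj: "cnj (inverse (1 - hermitian_inner w a)) = Q"
    "cnj (1 - hermitian_inner w a / (1 + s)) = 1 - y" "cnj s = s"
    by (simp_all add: q_def y_def Q_def cnj_hermitian_inner s_def)
  have "hermitian_inner (ball_involution z) (ball_involution w) =
      P * Q * ((1 - x) * (1 - y) * (1 - s\<^sup>2) - s * (1 - x) * q - s * (1 - y) * p + s\<^sup>2 * r)"
    unfolding ball_involution_def s_def [symmetric] hermitian_inner_sesquilinear cnj hermitian_inner_defect
      p_def [symmetric] q_def [symmetric] r_def [symmetric] s_def [symmetric] x_def [symmetric] P_def [symmetric]
    by (simp add: algebra_simps power2_eq_square)
  also have "(1 - x) * (1 - y) * (1 - s\<^sup>2) - s * (1 - x) * q - s * (1 - y) * p + s\<^sup>2 * r =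
      (1 - p) * (1 - q) - s\<^sup>2 * (1 - r)"
    unfolding pq by (simp add: algebra_simps power2_eq_square)
  finally show ?thesis
    unfolding p_def [symmetric] q_def [symmetric] r_def [symmetric] s_def [symmetric]
    using nz by (simp add: P_def Q_def divide_simps) (simp add: algebra_simps)
qed

text \<open>For \<open>w = z\<close> the right side of the kernel identity is a positive real,
  because its denominator is a squared modulus.\<close>

lemma ball_involution_in_ball:
  assumes "norm z < 1"
  shows "norm (ball_involution z) < 1"
proof -
  have "complex_of_real (1 - (norm (ball_involution z))\<^sup>2) =
      of_real (defect\<^sup>2 * (1 - (norm z)\<^sup>2) / (cmod (1 - hermitian_inner z a))\<^sup>2)"
    using ball_involution_kernel [OF assms assms]
    by (simp add: hermitian_inner_self complex_norm_square [unfolded of_real_power] cnj_hermitian_inner)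
  then have "1 - (norm (ball_involution z))\<^sup>2 =
      defect\<^sup>2 * (1 - (norm z)\<^sup>2) / (cmod (1 - hermitian_inner z a))\<^sup>2"
    using of_real_eq_iff by blast
  also have "\<dots> > 0"
    using one_minus_hermitian_inner_nonzero [OF assms] assms defect_pos
    by (intro divide_pos_pos mult_pos_pos) (auto simp: power_less_one_iff)
  finally show ?thesis
    by (simp add: power_less_one_iff)
qed

text \<open>The product of the image with \<open>a\<close> is
  \<open>1 - s\<^sup>2 / (1 - p)\<close>, so the second application divides by
  \<open>s\<^sup>2 / (1 - p)\<close>. Expanding then leaves coefficient \<open>1\<close> on
  \<open>z\<close> and \<open>0\<close> on \<open>a\<close>.\<close>

lemma ball_involution_involution:
  assumes "norm z < 1"
  shows "ball_involution (ball_involution z) = z"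
proof -
  define s where "s = complex_of_real defect"
  define p where "p = hermitian_inner z a"
  have nz: "1 - p \<noteq> 0" "1 + s \<noteq> 0" "s \<noteq> 0"
    using one_minus_hermitian_inner_nonzero assms defect_nonzero by (auto simp: p_def s_def)
  have phi: "ball_involution z = inverse (1 - p) *s ((1 - p / (1 + s)) *s a - s *s z)"
    by (simp add: ball_involution_def p_def s_def)
  have "hermitian_inner (ball_involution z) a =
      inverse (1 - p) * ((1 - p / (1 + s)) * (1 - s\<^sup>2) - s * p)"
    unfolding phi hermitian_inner_sesquilinear hermitian_inner_defect
    by (simp add: p_def s_def)
  also have "(1 - p / (1 + s)) * (1 - s\<^sup>2) - s * p = (1 - p) - s\<^sup>2"
  proof -
    have "p / (1 + s) * (1 - s\<^sup>2) = p * (1 - s)"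
      using nz by (simp add: divide_simps) (simp add: algebra_simps power2_eq_square)
    then show ?thesis by (simp add: algebra_simps)
  qed
  also have "inverse (1 - p) * ((1 - p) - s\<^sup>2) = 1 - s\<^sup>2 / (1 - p)"
    using nz by (simp add: field_simps)
  finally have pp: "hermitian_inner (ball_involution z) a = 1 - s\<^sup>2 / (1 - p)" .
  \<comment> \<open>\<open>\<kappa>\<close> and \<open>l\<close> are the scalar prefactors of the
    outer and inner application, \<open>\<mu>\<close> and \<open>\<nu>\<close> their coefficients of
    \<open>a\<close>; naming them keeps the vector expansion free of division.\<close>
  define \<kappa> l \<mu> \<nu> where "\<kappa> = (1 - p) / s\<^sup>2" and "l = inverse (1 - p)"
    and "\<mu> = 1 - (1 - s\<^sup>2 / (1 - p)) / (1 + s)" and "\<nu> = 1 - p / (1 + s)"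
  have "ball_involution (ball_involution z) = \<kappa> *s (\<mu> *s a - s *s ball_involution z)"
    unfolding ball_involution_def [of "ball_involution z"] pp by (simp add: s_def \<kappa>_def \<mu>_def)
  also have "\<dots> = \<kappa> *s (\<mu> *s a - s *s (l *s (\<nu> *s a - s *s z)))"
    by (simp add: phi \<nu>_def l_def)
  also have "\<dots> = (\<kappa> * (\<mu> - s * l * \<nu>)) *s a + (\<kappa> * s * l * s) *s z"
    by (simp add: vec_eq_iff algebra_simps)
  also have "\<kappa> * s * l * s = 1"
    using nz by (simp add: \<kappa>_def l_def power2_eq_square)
  also have "\<mu> - s * l * \<nu> = 0"
  proof -
    \<comment> \<open>The identity is checked after multiplication by the nonzero
      \<open>1 + s\<close>.\<close>
    have "s\<^sup>2 * l = s\<^sup>2 / (1 - p)"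
      by (simp add: l_def divide_inverse)
    then have "(1 + s) * \<mu> = (1 + s) - (1 - s\<^sup>2 * l)" "(1 + s) * \<nu> = (1 + s) - p"
      unfolding \<mu>_def \<nu>_def right_diff_distrib using nz by simp_all
    then have "(1 + s) * (\<mu> - s * l * \<nu>) = (1 + s) - (1 - s\<^sup>2 * l) - s * l * ((1 + s) - p)"
      by (simp add: right_diff_distrib mult.left_commute [of "1 + s"])
    also have "\<dots> = s - s * (l * (1 - p))"
      by (simp add: algebra_simps power2_eq_square)
    also have "\<dots> = 0"
      using nz by (simp add: l_def)
    finally show ?thesis using nz by simp
  qed
  finally show ?thesis by simp
qed

text \<open>The variable enters only through \<open>*s\<close> and the first, complex linear
  argument of \<open>hermitian_inner\<close>, so the product rule yields a complex linear
  derivative.\<close>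

lemma ball_involution_holomorphic: "holomorphic_map_on ball_involution (ball 0 1)"
  unfolding holomorphic_map_on_def
proof
  fix z :: "complex ^ 'n" assume "z \<in> ball 0 1"
  then have nz: "1 - hermitian_inner z a \<noteq> 0"
    using one_minus_hermitian_inner_nonzero by simp
  define s where "s = complex_of_real defect"
  define \<kappa> where "\<kappa> = inverse (1 - hermitian_inner z a)"
  define \<mu> where "\<mu> = inverse (1 + s)"
  have L: "((\<lambda>z. hermitian_inner z a) has_derivative (\<lambda>h. hermitian_inner h a)) (at z)"
    by (rule bounded_linear_imp_has_derivative [OF bounded_linear_hermitian_inner])
  have 1: "((\<lambda>z. inverse (1 - hermitian_inner z a)) has_derivative
      (\<lambda>h. \<kappa> * hermitian_inner h a * \<kappa>)) (at z)"
    using nz by (auto intro!: derivative_eq_intros L simp: \<kappa>_def)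
  have 2: "((\<lambda>z. 1 - hermitian_inner z a * \<mu>) has_derivative (\<lambda>h. - (hermitian_inner h a * \<mu>))) (at z)"
    by (auto intro!: derivative_eq_intros L)
  have 3: "((\<lambda>z. (1 - hermitian_inner z a * \<mu>) *s a - s *s z) has_derivative
      (\<lambda>h. (- (hermitian_inner h a * \<mu>)) *s a - s *s h)) (at z)"
    by (intro has_derivative_diff bounded_linear_imp_has_derivative
        bounded_linear.has_derivative [OF bounded_bilinear.bounded_linear_left [OF bounded_bilinear_scale] 2]
        bounded_bilinear.bounded_linear_right [OF bounded_bilinear_scale])
  note D = bounded_bilinear.FDERIV [OF bounded_bilinear_scale 1 3]
  show "\<exists>D. (ball_involution has_derivative D) (at z) \<and> (\<forall>c v. D (c *s v) = c *s D v)"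
    unfolding ball_involution_def [abs_def] s_def [symmetric] divide_inverse \<mu>_def [symmetric]
    by (rule exI, rule conjI, rule D) (simp add: hermitian_inner_scale_left vec_eq_iff algebra_simps)
qed

lemma ball_involution_Aut: "ball_involution \<in> Aut_ball"
  by (rule Aut_ballI [of _ ball_involution])
    (simp_all add: ball_involution_holomorphic ball_involution_in_ball ball_involution_involution)

lemma ball_involution_0: "ball_involution 0 = a"
  by (simp add: ball_involution_def)

lemma ball_involution_self: "ball_involution a = 0"
  using ball_involution_involution [of 0] by (simp add: ball_involution_0)

end

text \<open>With \<open>a = \<Lambda> 0\<close>, following \<open>\<Lambda>\<close> by the
  involution at \<open>a\<close> fixes the origin and is therefore unitary; applying the involution
  once more recovers \<open>\<Lambda>\<close>.\<close>

lemma Aut_ball_decomposition: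
  assumes "\<Lambda> \<in> Aut_ball"
  obtains a D where "norm a < 1" "unitary_map D"
    "\<And>z. norm z < 1 \<Longrightarrow> \<Lambda> z = ball_involution a (D z)"
proof -
  define a where "a = \<Lambda> 0"
  have \<Lambda>: "norm (\<Lambda> z) < 1" if "norm z < 1" for z
    using Aut_ballD [OF assms] that by blast
  have a: "norm a < 1"
    unfolding a_def by (rule \<Lambda>) simp
  obtain D where D: "unitary_map D" "\<And>z. norm z < 1 \<Longrightarrow> (ball_involution a \<circ> \<Lambda>) z = D z"
    using Aut_ball_fixing_zero [OF Aut_ball_compose [OF assms ball_involution_Aut [OF a]]]
      ball_involution_self [OF a] by (auto simp: a_def)
  have "\<Lambda> z = ball_involution a (D z)" if "norm z < 1" for z
    using D(2) [OF that] ball_involution_involution [OF a \<Lambda> [OF that]] by simp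
  then show thesis
    using that a D(1) by blast
qed

section \<open>The angular invariant\<close>

text \<open>Around the cycle each \<open>c z\<close> meets its conjugate once, so the triple product
  is multiplied by the positive real \<open>\<rho>\<close>.\<close>

lemma angular_invariant_ball_involution:
  assumes a: "norm a < 1" and z: "norm z1 < 1" "norm z2 < 1" "norm z3 < 1"
  shows "angular_invariant (ball_involution a z1) (ball_involution a z2) (ball_involution a z3) =
    angular_invariant z1 z2 z3"
proof -
  define s where "s = complex_of_real (defect a)"
  define c where "c z = 1 - hermitian_inner z a" for z
  define \<rho> where "\<rho> = (cmod (c z1) * cmod (c z2) * cmod (c z3))\<^sup>2 / defect a ^ 6"
  have cnj_c: "cnj (c z) = 1 - hermitian_inner a z" for z
    by (simp add: c_def cnj_hermitian_inner)
  \<comment> \<open>\<open>DA_gram\<close> reverses the arguments of \<open>hermitian_inner\<close>,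
    hence the swapped instance of the kernel identity.\<close>
  have gram: "DA_gram (ball_involution a z) (ball_involution a w) = c w * cnj (c z) / s\<^sup>2 * DA_gram z w"
    if "norm z < 1" "norm w < 1" for z w
    unfolding DA_gram_def ball_involution_kernel [OF a that(2,1)] cnj_c
    by (simp add: c_def s_def divide_inverse mult_ac)
  have "of_real \<rho> = (c z1 * cnj (c z1)) * (c z2 * cnj (c z2)) * (c z3 * cnj (c z3)) / s ^ 6"
    unfolding complex_norm_square [symmetric]
    by (simp add: \<rho>_def s_def power_mult_distrib)
  then have "DA_gram (ball_involution a z1) (ball_involution a z2) *
      DA_gram (ball_involution a z2) (ball_involution a z3) *
      DA_gram (ball_involution a z3) (ball_involution a z1) =
      of_real \<rho> * (DA_gram z1 z2 * DA_gram z2 z3 * DA_gram z3 z1)"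
    by (simp add: gram z divide_inverse eval_nat_numeral mult_ac)
  moreover have "\<rho> > 0"
    using one_minus_hermitian_inner_nonzero [OF a] z defect_pos [OF a] by (simp add: \<rho>_def c_def)
  ultimately show ?thesis
    by (simp add: angular_invariant_def Arg_times_of_real)
qed

lemma angular_invariant_Aut_ball:
  assumes "\<Lambda> \<in> Aut_ball" and z: "norm z1 < 1" "norm z2 < 1" "norm z3 < 1"
  shows "angular_invariant (\<Lambda> z1) (\<Lambda> z2) (\<Lambda> z3) = angular_invariant z1 z2 z3"
proof -
  obtain a D where a: "norm a < 1" and D: "unitary_map D"
    and eq: "\<And>z. norm z < 1 \<Longrightarrow> \<Lambda> z = ball_involution a (D z)"
    using Aut_ball_decomposition [OF assms(1)] by blast
  have "norm (D z) = norm z" for z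
    using D by (simp add: unitary_map_def)
  then show ?thesis
    using angular_invariant_ball_involution [OF a, of "D z1" "D z2" "D z3"] z
    by (simp add: eq angular_invariant_def DA_gram_def unitary_map_hermitian_inner [OF D])
qed

text \<open>Inner products of points of the real disk are real and below \<open>1\<close>, so all
  Gram entries are positive reals.\<close>

lemma angular_invariant_real_plane:
  assumes "i \<noteq> j" and X: "\<And>k. k \<in> {x, y, z} \<Longrightarrow> norm k < 1 \<and> (\<exists>u v. k = plane_pt i j (of_real u) (of_real v))"
  shows "angular_invariant x y z = 0"
proof -
  have gram: "\<exists>r > 0. DA_gram k l = of_real r" if kl: "k \<in> {x, y, z}" "l \<in> {x, y, z}" for k l
  proof -
    obtain u v u' v' where "k = plane_pt i j (of_real u) (of_real v)" "l = plane_pt i j (of_real u') (of_real v')"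
      using X kl by meson
    then have "hermitian_inner l k = of_real (u' * u + v' * v)"
      using assms(1)
      by (simp add: plane_pt_def axis_eq_scale [of _ "of_real _"] hermitian_inner_sesquilinear
          hermitian_inner_axis) (simp add: axis_def)
    then obtain h where h: "hermitian_inner l k = of_real h" by blast
    have "norm l * norm k < 1"
      using X kl mult_strict_mono' [of "norm l" 1 "norm k" 1] by simp
    then have "h < 1"
      using norm_hermitian_inner_le [of l k] by (simp add: h)
    moreover have "DA_gram k l = of_real (inverse (1 - h))"
      by (simp add: DA_gram_def h)
    ultimately show ?thesis
      by (intro exI [of _ "inverse (1 - h)"]) simp
  qed
  obtain p q r where pqr: "p > 0" "DA_gram x y = of_real p" "q > 0" "DA_gram y z = of_real q"
    "r > 0" "DA_gram z x = of_real r"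
    using gram [of x y] gram [of y z] gram [of z x] by auto
  then have "\<not> p * q * r < 0" by (simp add: not_less)
  with pqr show ?thesis
    by (simp add: angular_invariant_def flip: of_real_mult)
qed

text \<open>Once \<open>y1\<close> is at the origin, the two Gram entries involving it equal
  \<open>1\<close>, so the triple product is the single entry of the other two points, and a
  vanishing argument makes that entry real.\<close>

lemma normal_form_if_angular_invariant_zero:
  fixes i j :: "'n::finite" and y1 y2 y3 :: "complex ^ 'n"
  assumes "i \<noteq> j" "y1 \<noteq> y2" "norm y1 < 1" "norm y2 < 1" "norm y3 < 1"
    and ang: "angular_invariant y1 y2 y3 = 0"
  obtains \<Lambda> and s w t :: real where "\<Lambda> \<in> Aut_ball" "s > 0" "t \<ge> 0"
    "\<Lambda> y1 = 0" "\<Lambda> y2 = plane_pt i j (of_real s) 0" "\<Lambda> y3 = plane_pt i j (of_real w) (of_real t)"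
proof -
  define \<phi> where "\<phi> = ball_involution y1"
  have \<phi>: "\<phi> \<in> Aut_ball" "\<phi> y1 = 0"
    using assms(3) by (auto simp: \<phi>_def ball_involution_Aut ball_involution_self)
  \<comment> \<open>Otherwise applying the involution again would give
    \<open>y2 = y1\<close>.\<close>
  have "\<phi> y2 \<noteq> 0"
    using ball_involution_involution [OF assms(3,4)] ball_involution_0 [OF assms(3)] assms(2)
    by (metis \<phi>_def)
  have "angular_invariant 0 (\<phi> y2) (\<phi> y3) = 0"
    using angular_invariant_Aut_ball [OF \<phi>(1) assms(3-5)] ang \<phi>(2) by simp
  then have "DA_gram (\<phi> y2) (\<phi> y3) \<in> \<real>"
    by (simp add: angular_invariant_def DA_gram_def Arg_eq_0)
  \<comment> \<open>Inverting the Gram entry recovers the inner product as a real number.\<close>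
  then have "1 - inverse (DA_gram (\<phi> y2) (\<phi> y3)) \<in> \<real>"
    by (intro Reals_diff Reals_1 Reals_inverse)
  then have "hermitian_inner (\<phi> y3) (\<phi> y2) \<in> \<real>"
    by (simp add: DA_gram_def)
  then obtain U and s w t :: real where "unitary_map U" "s > 0" "t \<ge> 0"
    "U (\<phi> y2) = plane_pt i j (of_real s) 0" "U (\<phi> y3) = plane_pt i j (of_real w) (of_real t)"
    using exists_unitary_normal_form [OF assms(1) \<open>\<phi> y2 \<noteq> 0\<close>] by metis
  then show thesis
    using that [of "U \<circ> \<phi>" s t w] Aut_ball_compose [OF \<phi>(1) unitary_map_Aut_ball]
    by (simp add: \<phi>(2) unitary_map_zero)
qed

section \<open>Disks, geodesics and the degenerate case\<close>

text \<open>Disks and geodesics are images of a model set, whereas congruence moves the given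
  points; the inverse automorphism passes from one view to the other.\<close>

lemma subset_Aut_ball_image_iff:
  assumes "S \<subseteq> ball 0 1" "Y \<subseteq> ball 0 1"
  shows "(\<exists>\<Lambda>\<in>Aut_ball. Y \<subseteq> \<Lambda> ` S) \<longleftrightarrow> (\<exists>\<Lambda>\<in>Aut_ball. \<Lambda> ` Y \<subseteq> S)"
proof
  assume "\<exists>\<Lambda>\<in>Aut_ball. Y \<subseteq> \<Lambda> ` S"
  then obtain \<Lambda> where \<Lambda>: "\<Lambda> \<in> Aut_ball" "Y \<subseteq> \<Lambda> ` S" by blast
  obtain \<Lambda>' where \<Lambda>': "\<Lambda>' \<in> Aut_ball" "\<And>z. norm z < 1 \<Longrightarrow> \<Lambda>' (\<Lambda> z) = z"
    using Aut_ballD [OF \<Lambda>(1)] by metis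
  have "\<Lambda>' (\<Lambda> x) \<in> S" if "x \<in> S" for x
    using \<Lambda>'(2) [of x] that assms(1) by auto
  then have "\<Lambda>' ` Y \<subseteq> S"
    using \<Lambda>(2) by auto
  with \<Lambda>'(1) show "\<exists>\<Lambda>\<in>Aut_ball. \<Lambda> ` Y \<subseteq> S" by (intro bexI [of _ \<Lambda>'])
next
  assume "\<exists>\<Lambda>\<in>Aut_ball. \<Lambda> ` Y \<subseteq> S"
  then obtain \<Lambda> where \<Lambda>: "\<Lambda> \<in> Aut_ball" "\<Lambda> ` Y \<subseteq> S" by blast
  obtain \<Lambda>' where \<Lambda>': "\<Lambda>' \<in> Aut_ball" "\<And>z. norm z < 1 \<Longrightarrow> \<Lambda>' (\<Lambda> z) = z"
    using Aut_ballD [OF \<Lambda>(1)] by metis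
  have "y \<in> \<Lambda>' ` S" if "y \<in> Y" for y
  proof (rule image_eqI)
    show "y = \<Lambda>' (\<Lambda> y)" using \<Lambda>'(2) [of y] assms(2) that by auto
    show "\<Lambda> y \<in> S" using \<Lambda>(2) that by auto
  qed
  with \<Lambda>'(1) show "\<exists>\<Lambda>\<in>Aut_ball. Y \<subseteq> \<Lambda> ` S"
    by blast
qed

text \<open>Following \<open>N\<close> by the involution at \<open>N 0\<close> gives an automorphism
  fixing \<open>0\<close>, hence a unitary map. It would send the linearly independent points
  \<open>(s, 0)\<close> and \<open>(w, t)\<close> into one line, which injectivity forbids.\<close>

lemma not_in_diameter:
  assumes "i \<noteq> j" "s \<noteq> 0" "t \<noteq> 0" "N \<in> Aut_ball"
    and ball: "norm (plane_pt i j (of_real s) 0) < 1" "norm (plane_pt i j (of_real w) (of_real t)) < 1"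
    and N: "N 0 = axis i (of_real x1)" "N (plane_pt i j (of_real s) 0) = axis i (of_real x2)"
      "N (plane_pt i j (of_real w) (of_real t)) = axis i (of_real x3)"
  shows False
proof -
  define a where "a = axis i (complex_of_real x1)"
  have a: "norm a < 1"
    using Aut_ballD [OF assms(4)] N(1) by (metis a_def norm_zero zero_less_one)
  define F where "F = ball_involution a \<circ> N"
  have "F \<in> Aut_ball" "F 0 = 0"
    using Aut_ball_compose [OF assms(4) ball_involution_Aut [OF a]] ball_involution_self [OF a] N(1)
    by (auto simp: F_def a_def)
  then obtain D where D: "unitary_map D" "\<And>z. norm z < 1 \<Longrightarrow> F z = D z"
    using Aut_ball_fixing_zero by blast
  have Dlin: "D (x + y) = D x + D y" "D (c *s x) = c *s D x" and Dnorm: "norm (D x) = norm x" for x y c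
    using D(1) by (auto simp: unitary_map_def)
  \<comment> \<open>The involution at a real point of the axis has real coefficients there, so it
    keeps the diameter on its line.\<close>
  have line: "\<exists>r :: real. ball_involution a (axis i (of_real x)) = of_real r *s axis i 1" for x
  proof -
    have "hermitian_inner (axis i (of_real x)) a = of_real (x * x1)"
      by (simp add: a_def axis_eq_scale [of _ "of_real _"] hermitian_inner_sesquilinear hermitian_inner_axis)
    then show ?thesis
      unfolding ball_involution_def [OF a]
      by (intro exI [of _ "inverse (1 - x * x1) * ((1 - x * x1 / (1 + defect a)) * x1 - defect a * x)"])
        (simp add: a_def axis_eq_scale [of _ "of_real _"] vec_eq_iff algebra_simps)
  qed
  obtain r where r: "D (plane_pt i j (of_real s) 0) = of_real r *s axis i 1"
    using line [of x2] D(2) [OF ball(1)] N(2) by (auto simp: F_def)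
  obtain q where q: "D (plane_pt i j (of_real w) (of_real t)) = of_real q *s axis i 1"
    using line [of x3] D(2) [OF ball(2)] N(3) by (auto simp: F_def)
  \<comment> \<open>The combination in which the two images cancel. Its coordinate at
    \<open>j\<close> is \<open>- r * t\<close>, which forces \<open>r = 0\<close>; then
    \<open>D\<close> annihilates the nonzero point \<open>(s, 0)\<close>.\<close>
  define v where "v = of_real q *s plane_pt i j (of_real s) 0 + of_real (- r) *s plane_pt i j (of_real w) (of_real t)"
  have "D v = 0"
    unfolding v_def Dlin r q by (simp add: vec_eq_iff)
  then have "v = 0"
    using Dnorm [of v] by simp
  then have "v $ j = 0" by simp
  then have "r = 0"
    using assms(1,3) by (simp add: v_def plane_pt_def axis_def)
  then have "plane_pt i j (of_real s) 0 = (0 :: complex ^ 'a)"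
    using r Dnorm [of "plane_pt i j (of_real s) 0"] by simp
  then have "plane_pt i j (of_real s) 0 $ i = (0 :: complex)" by simp
  then show False
    using assms(1,2) by (simp add: plane_pt_def axis_def)
qed

text \<open>The normal form with \<open>t \<ge> 0\<close> yields the first equivalence. In the
  second, \<open>t = 0\<close> puts the triple on a diameter, while \<open>t > 0\<close> keeps it
  off every real geodesic by \<open>not_in_diameter\<close>; this accounts for the excluded
  degenerate case.\<close>

theorem proposition25:
  fixes i j :: "'n::finite" and y1 y2 y3 :: "complex ^ 'n"
  assumes "i \<noteq> j"
    and "distinct [y1, y2, y3]"
    and "set [y1, y2, y3] \<subseteq> ball 0 1"
  shows "((\<exists>D \<in> real_geodesic_disks i j. set [y1, y2, y3] \<subseteq> D) \<longleftrightarrow>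
            angular_invariant y1 y2 y3 = 0) \<and>
         ((\<exists>X \<in> normal_triples i j. congruent_pts [y1, y2, y3] X) \<longleftrightarrow>
            (\<exists>D \<in> real_geodesic_disks i j. set [y1, y2, y3] \<subseteq> D) \<and>
            \<not> (\<exists>G \<in> real_geodesics i. set [y1, y2, y3] \<subseteq> G))"
proof -
  define S where "S = {plane_pt i j (of_real x) (of_real y) | x y :: real. x\<^sup>2 + y\<^sup>2 < 1}"
  define L where "L = {axis i (complex_of_real x) | x :: real. x\<^sup>2 < 1}"
  define Y where "Y = {y1, y2, y3}"
  have y: "norm y1 < 1" "norm y2 < 1" "norm y3 < 1"
    using assms(3) by auto
  have S_iff: "plane_pt i j (of_real x) (of_real y) \<in> S" if "norm (plane_pt i j (of_real x) (of_real y)) < 1" for x y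
  proof -
    have "x\<^sup>2 + y\<^sup>2 < 1"
      using that by (simp add: power_less_one_iff flip: norm_plane_pt [OF assms(1)])
    then show ?thesis by (auto simp: S_def)
  qed
  have S_ball: "norm z < 1" if "z \<in> S" for z
    using that unfolding S_def
    by (auto simp: power_less_one_iff simp flip: norm_plane_pt [OF assms(1)])
  \<comment> \<open>Writing the zero coordinate as \<open>of_real 0\<close> matches the shape of the
    elements of \<open>S\<close>.\<close>
  have L_eq: "axis i (complex_of_real x) = plane_pt i j (of_real x) (of_real 0)" for x
    by (simp add: plane_pt_def axis_def vec_eq_iff)
  have L_S: "L \<subseteq> S"
    unfolding L_def S_def L_eq by auto (metis add.right_neutral of_real_0 zero_power2)
  have SLY: "S \<subseteq> ball 0 1" "L \<subseteq> ball 0 1" "Y \<subseteq> ball 0 1"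
    using S_ball L_S y by (auto simp: Y_def)
  have disk: "(\<exists>D \<in> real_geodesic_disks i j. set [y1, y2, y3] \<subseteq> D) \<longleftrightarrow> (\<exists>\<Lambda>\<in>Aut_ball. \<Lambda> ` Y \<subseteq> S)"
    unfolding subset_Aut_ball_image_iff [OF SLY(1,3), symmetric]
    by (auto simp: real_geodesic_disks_def S_def Y_def)
  have geod: "(\<exists>G \<in> real_geodesics i. set [y1, y2, y3] \<subseteq> G) \<longleftrightarrow> (\<exists>\<Lambda>\<in>Aut_ball. \<Lambda> ` Y \<subseteq> L)"
    unfolding subset_Aut_ball_image_iff [OF SLY(2,3), symmetric]
    by (auto simp: real_geodesics_def L_def Y_def)
  have norm_Aut: "norm (\<Lambda> z) < 1" if "\<Lambda> \<in> Aut_ball" "norm z < 1" for \<Lambda> and z :: "complex ^ 'n"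
    using Aut_ballD [OF that(1)] that(2) by blast

  have ang0: "angular_invariant y1 y2 y3 = 0" if "\<exists>\<Lambda>\<in>Aut_ball. \<Lambda> ` Y \<subseteq> S"
  proof -
    obtain \<Lambda> where \<Lambda>: "\<Lambda> \<in> Aut_ball" "\<Lambda> ` Y \<subseteq> S" using \<open>\<exists>\<Lambda>\<in>Aut_ball. _\<close> by blast
    have "angular_invariant (\<Lambda> y1) (\<Lambda> y2) (\<Lambda> y3) = 0"
    proof (rule angular_invariant_real_plane [OF assms(1)])
      fix k assume "k \<in> {\<Lambda> y1, \<Lambda> y2, \<Lambda> y3}"
      then have "k \<in> S" using \<Lambda>(2) by (auto simp: Y_def)
      then show "norm k < 1 \<and> (\<exists>u v. k = plane_pt i j (of_real u) (of_real v))"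
        using S_ball by (auto simp: S_def)
    qed
    then show ?thesis
      using angular_invariant_Aut_ball [OF \<Lambda>(1) y] by simp
  qed
  have normal: "\<exists>\<Lambda>\<in>Aut_ball. \<exists>s w t :: real. s > 0 \<and> t \<ge> 0 \<and> \<Lambda> y1 = 0 \<and>
      \<Lambda> y2 = plane_pt i j (of_real s) 0 \<and> \<Lambda> y3 = plane_pt i j (of_real w) (of_real t)"
    if "angular_invariant y1 y2 y3 = 0"
    using normal_form_if_angular_invariant_zero [OF assms(1) _ y that] assms(2) by (metis distinct_length_2_or_more)
  have in_S: "\<Lambda> ` Y \<subseteq> S" if "\<Lambda> \<in> Aut_ball" "\<Lambda> y1 = 0"
    "\<Lambda> y2 = plane_pt i j (of_real s) 0" "\<Lambda> y3 = plane_pt i j (of_real w) (of_real t)" for \<Lambda> and s w t :: real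
  proof -
    have "\<Lambda> y1 = plane_pt i j (of_real 0) (of_real 0)" "\<Lambda> y2 = plane_pt i j (of_real s) (of_real 0)"
      using that by (simp_all add: plane_pt_def axis_def vec_eq_iff)
    then have "\<Lambda> y1 \<in> S" "\<Lambda> y2 \<in> S" "\<Lambda> y3 \<in> S"
      using S_iff norm_Aut [OF that(1)] y that(4) by metis+
    then show ?thesis
      by (simp add: Y_def)
  qed
  have 1: "(\<exists>\<Lambda>\<in>Aut_ball. \<Lambda> ` Y \<subseteq> S) \<longleftrightarrow> angular_invariant y1 y2 y3 = 0"
    using ang0 normal in_S by meson
  have 2: "(\<exists>X \<in> normal_triples i j. congruent_pts [y1, y2, y3] X) \<longleftrightarrow>
      (\<exists>\<Lambda>\<in>Aut_ball. \<Lambda> ` Y \<subseteq> S) \<and> \<not> (\<exists>\<Lambda>\<in>Aut_ball. \<Lambda> ` Y \<subseteq> L)" (is "?N \<longleftrightarrow> ?D \<and> \<not> ?G")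
  proof
    assume ?N
    then obtain \<Lambda> and s w t :: real where \<Lambda>: "\<Lambda> \<in> Aut_ball" and st: "s > 0" "t > 0"
      and \<Lambda>y: "\<Lambda> y1 = 0" "\<Lambda> y2 = plane_pt i j (of_real s) 0" "\<Lambda> y3 = plane_pt i j (of_real w) (of_real t)"
      by (auto simp: normal_triples_def congruent_pts_def)
    have ?D using in_S [OF \<Lambda> \<Lambda>y] \<Lambda> by blast
    moreover have False if ?G
    proof -
      obtain M where M: "M \<in> Aut_ball" "M ` Y \<subseteq> L" using \<open>?G\<close> by blast
      have "\<exists>x. M y = axis i (complex_of_real x)" if "y \<in> Y" for y
        using M(2) that unfolding L_def by blast
      from this [of y1] this [of y2] this [of y3] obtain x1 x2 x3
        where x: "M y1 = axis i (of_real x1)" "M y2 = axis i (of_real x2)" "M y3 = axis i (of_real x3)"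
        unfolding Y_def by (meson insertI1 insertI2)
      \<comment> \<open>Undoing \<open>\<Lambda>\<close> before applying \<open>M\<close> carries
        the normal triple into the diameter, as \<open>not_in_diameter\<close> excludes.\<close>
      obtain \<Lambda>' where \<Lambda>': "\<Lambda>' \<in> Aut_ball" "\<And>z. norm z < 1 \<Longrightarrow> \<Lambda>' (\<Lambda> z) = z"
        using Aut_ballD [OF \<Lambda>] by metis
      show False
      proof (rule not_in_diameter [OF assms(1)])
        show "M \<circ> \<Lambda>' \<in> Aut_ball" using Aut_ball_compose [OF \<Lambda>'(1) M(1)] .
        show "norm (plane_pt i j (of_real s) 0) < 1" "norm (plane_pt i j (of_real w) (of_real t)) < 1"
          using norm_Aut [OF \<Lambda>] y \<Lambda>y by metis+
        show "(M \<circ> \<Lambda>') 0 = axis i (of_real x1)" "(M \<circ> \<Lambda>') (plane_pt i j (of_real s) 0) = axis i (of_real x2)"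
          "(M \<circ> \<Lambda>') (plane_pt i j (of_real w) (of_real t)) = axis i (of_real x3)"
          using \<Lambda>'(2) [OF y(1)] \<Lambda>'(2) [OF y(2)] \<Lambda>'(2) [OF y(3)] x by (simp_all add: \<Lambda>y)
      qed (use st in auto)
    qed
    ultimately show "?D \<and> \<not> ?G" by blast
  next
    \<comment> \<open>The map \<open>\<Lambda>\<close> obtained next is not the one placing the
      points in \<open>S\<close>: the disk gives a zero argument, and this in turn gives the normal
      form.\<close>
    assume DG: "?D \<and> \<not> ?G"
    then obtain \<Lambda> and s w t :: real where \<Lambda>: "\<Lambda> \<in> Aut_ball" and st: "s > 0" "t \<ge> 0"
      and \<Lambda>y: "\<Lambda> y1 = 0" "\<Lambda> y2 = plane_pt i j (of_real s) 0" "\<Lambda> y3 = plane_pt i j (of_real w) (of_real t)"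
      using normal ang0 by meson
    \<comment> \<open>For \<open>t = 0\<close> the map \<open>\<Lambda>\<close> itself would place
      all three points on the diameter, against the assumption on geodesics.\<close>
    have "t \<noteq> 0"
    proof
      assume "t = 0"
      have "z \<in> L" if z: "z \<in> \<Lambda> ` Y" for z
      proof -
        have "0 = axis i (complex_of_real 0)"
          by (simp add: axis_def vec_eq_iff)
        moreover have "z \<in> {0, axis i (complex_of_real s), axis i (complex_of_real w)}"
          using z \<Lambda>y \<open>t = 0\<close> L_eq [of s] L_eq [of w] by (auto simp: Y_def)
        ultimately obtain x where x: "z = axis i (complex_of_real x)"
          by (metis empty_iff insert_iff)
        have "norm z < 1"
          using z SLY(3) norm_Aut [OF \<Lambda>] by auto
        then have "x\<^sup>2 < 1"
          by (simp add: x axis_eq_scale [of _ "of_real _"] norm_scale abs_square_less_1)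
        then show ?thesis
          using x by (auto simp: L_def)
      qed
      then show False using DG \<Lambda> by blast
    qed
    with st have "t > 0" by simp
    have "[0, plane_pt i j (of_real s) 0, plane_pt i j (of_real w) (of_real t)] \<in> normal_triples i j"
      unfolding normal_triples_def
      by (rule CollectI, rule exI [of _ s], rule exI [of _ w], rule exI [of _ t])
        (use st \<open>t > 0\<close> norm_Aut [OF \<Lambda> y(2)] norm_Aut [OF \<Lambda> y(3)] in \<open>simp add: \<Lambda>y\<close>)
    moreover have "congruent_pts [y1, y2, y3] [0, plane_pt i j (of_real s) 0, plane_pt i j (of_real w) (of_real t)]"
      unfolding congruent_pts_def by (rule bexI [OF _ \<Lambda>]) (simp add: \<Lambda>y)
    ultimately show ?N by (intro bexI)
  qed
  show ?thesis
    unfolding disk geod using 1 2 by (rule conjI)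
qed

end
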